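(* Let $X$ be a finite set with at least three elements, let $\mathcal{P}=\{X_i \mid i\in I_m\}$ be a partition of $X$ into exactly $m$ blocks, and let $f\in\Sigma(X,\mathcal{P})$. Then $f$ is a unit-regular element of the semigroup $\Sigma(X,\mathcal{P})$ if and only if for all $i,j\in I_m$ we have $|X_i|=|X_j|$ whenever $i\chi^{(f)}=j$.
   Context: Maps are written on the right and composed from left to right: $xf$ is the image of $x$ under $f$, $x(fg)=(xf)g$, and $Af$ is the image of a subset $A$ under $f$. $I_m=\{1,\dots,m\}$. A partition of $X$ is a collection of nonempty pairwise disjoint subsets (blocks) with union $X$; distinct indices correspond to distinct blocks. $\mathcal{T}_X$ is the semigroup of all maps $X\to X$ under composition. $T(X,\mathcal{P})=\{f\in\mathcal{T}_X \mid (\forall X_i\in\mathcal{P})(\exists X_j\in\mathcal{P})\; X_if\subseteq X_j\}$, and $\Sigma(X,\mathcal{P})=\{f\in T(X,\mathcal{P}) \mid (\forall X_i\in\mathcal{P})\; Xf\cap X_i\neq\emptyset\}$, which is a subsemigroup containing the identity map. For $f\in T(X,\mathcal{P})$, the character of $f$ is the map $\chi^{(f)}\colon I_m\to I_m$ defined by $i\chi^{(f)}=j$ whenever $X_if\subseteq X_j$. An element $a$ of a semigroup $S$ with identity is unit-regular if there is a unit (invertible element) $u\in S$ with $a=aua$. *)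

theory Defs
  imports "HOL-Algebra.Group" "HOL-Library.FuncSet" "HOL-Library.Disjoint_Sets"
begin

definition index_set :: "nat \<Rightarrow> nat set" where
  "index_set m = {1..m}"

text \<open>A partition of \<open>X\<close> given as an indexed family \<open>(P i)\<close> for \<open>i \<in> index_set m\<close>.
  Injectivity says that distinct indices give distinct blocks, so there are exactly \<open>m\<close> blocks.\<close>

definition indexed_partition :: "'a set \<Rightarrow> nat \<Rightarrow> (nat \<Rightarrow> 'a set) \<Rightarrow> bool" where
  "indexed_partition X m P \<longleftrightarrow> partition_on X (P ` index_set m) \<and> inj_on P (index_set m)"

text \<open>Maps \<open>X \<rightarrow> X\<close> are represented by the extensional functions \<open>X \<rightarrow>\<^sub>E X\<close>
  (\<open>undefined\<close> outside \<open>X\<close>), so that two maps are equal iff they agree on \<open>X\<close>.\<close>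

definition T_part :: "'a set \<Rightarrow> 'a set set \<Rightarrow> ('a \<Rightarrow> 'a) set" where
  "T_part X \<P> = {f \<in> X \<rightarrow>\<^sub>E X. \<forall>A\<in>\<P>. \<exists>B\<in>\<P>. f ` A \<subseteq> B}"

definition Sigma_part :: "'a set \<Rightarrow> 'a set set \<Rightarrow> ('a \<Rightarrow> 'a) set" where
  "Sigma_part X \<P> = {f \<in> T_part X \<P>. \<forall>A\<in>\<P>. f ` X \<inter> A \<noteq> {}}"

text \<open>Maps compose from left to right: the product of \<open>f\<close> and \<open>g\<close> sends \<open>x \<in> X\<close> to
  \<open>g (f x)\<close>.\<close>

definition Sigma_monoid :: "'a set \<Rightarrow> 'a set set \<Rightarrow> ('a \<Rightarrow> 'a) monoid" where
  "Sigma_monoid X \<P> =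
     \<lparr>carrier = Sigma_part X \<P>, mult = (\<lambda>f g. compose X g f), one = (\<lambda>x\<in>X. x)\<rparr>"

definition character :: "nat \<Rightarrow> (nat \<Rightarrow> 'a set) \<Rightarrow> ('a \<Rightarrow> 'a) \<Rightarrow> nat \<Rightarrow> nat" where
  "character m P f = (\<lambda>i\<in>index_set m. THE j. j \<in> index_set m \<and> f ` P i \<subseteq> P j)"

definition unit_regular :: "('a, 'b) monoid_scheme \<Rightarrow> 'a \<Rightarrow> bool" where
  "unit_regular S a \<longleftrightarrow>
     a \<in> carrier S \<and> (\<exists>u\<in>Units S. a = a \<otimes>\<^bsub>S\<^esub> u \<otimes>\<^bsub>S\<^esub> a)"

lemma Sigma_part_compose:
  assumes part: "partition_on X \<P>" and f: "f \<in> Sigma_part X \<P>" and g: "g \<in> Sigma_part X \<P>"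
  shows "compose X g f \<in> Sigma_part X \<P>"
proof -
  have U: "\<Union>\<P> = X" and disj: "disjoint \<P>"
    using part by (simp_all add: partition_on_def)
  have maps: "h x \<in> X" if "h \<in> Sigma_part X \<P>" "x \<in> X" for h x
    using that unfolding Sigma_part_def T_part_def by blast
  have block: "\<exists>B\<in>\<P>. h ` A \<subseteq> B" if "h \<in> Sigma_part X \<P>" "A \<in> \<P>" for h A
    using that unfolding Sigma_part_def T_part_def by blast
  have meets: "\<exists>x\<in>X. h x \<in> A" if "h \<in> Sigma_part X \<P>" "A \<in> \<P>" for h A
    using that unfolding Sigma_part_def by blast
  have comp: "compose X g f x = g (f x)" if "x \<in> X" for x
    using that by (simp add: compose_def)
  have 1: "compose X g f \<in> X \<rightarrow>\<^sub>E X"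
    by (simp add: PiE_iff comp maps f g)
  have 2: "\<exists>C\<in>\<P>. compose X g f ` A \<subseteq> C" if A: "A \<in> \<P>" for A
  proof -
    obtain B where B: "B \<in> \<P>" "f ` A \<subseteq> B" using block[OF f A] by blast
    obtain C where C: "C \<in> \<P>" "g ` B \<subseteq> C" using block[OF g B(1)] by blast
    have "compose X g f x \<in> C" if "x \<in> A" for x
    proof -
      have "x \<in> X" using that A U by blast
      moreover have "g (f x) \<in> C" using that B(2) C(2) by blast
      ultimately show ?thesis by (simp add: comp)
    qed
    then show ?thesis using C(1) by blast
  qed
  have 3: "compose X g f ` X \<inter> C \<noteq> {}" if C: "C \<in> \<P>" for C
  proof -
    obtain y where y: "y \<in> X" "g y \<in> C" using meets[OF g C] by blast
    obtain B where B: "B \<in> \<P>" "y \<in> B" using y(1) U by blast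
    obtain D where D: "D \<in> \<P>" "g ` B \<subseteq> D" using block[OF g B(1)] by blast
    have "g y \<in> D" using B(2) D(2) by blast
    then have "D = C" using disjointD[OF disj D(1) C] y(2) by blast
    obtain x where x: "x \<in> X" "f x \<in> B" using meets[OF f B(1)] by blast
    have "g (f x) \<in> C" using x(2) D(2) \<open>D = C\<close> by blast
    then have "compose X g f x \<in> C" by (simp add: comp x(1))
    then show ?thesis using x(1) by blast
  qed
  show ?thesis using 1 2 3 unfolding Sigma_part_def T_part_def by blast
qed

lemma Sigma_part_id:
  assumes "partition_on X \<P>"
  shows "(\<lambda>x\<in>X. x) \<in> Sigma_part X \<P>"
proof -
  have sub: "A \<subseteq> X" and ne: "A \<noteq> {}" if "A \<in> \<P>" for A
    using that assms by (auto simp: partition_on_def)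
  have img: "(\<lambda>x\<in>X. x) ` A = A" if "A \<subseteq> X" for A
  proof -
    have "(\<lambda>x\<in>X. x) ` A = (\<lambda>x. x) ` A"
      by (rule image_cong) (use that in auto)
    then show ?thesis by simp
  qed
  have "\<exists>B\<in>\<P>. (\<lambda>x\<in>X. x) ` A \<subseteq> B" if "A \<in> \<P>" for A
    using that img[OF sub[OF that]] by blast
  moreover have "(\<lambda>x\<in>X. x) ` X \<inter> A \<noteq> {}" if "A \<in> \<P>" for A
    using img[of X] sub[OF that] ne[OF that] by blast
  moreover have "(\<lambda>x\<in>X. x) \<in> X \<rightarrow>\<^sub>E X" by simp
  ultimately show ?thesis unfolding Sigma_part_def T_part_def by blast
qed

lemma Sigma_monoid_monoid:
  assumes "partition_on X \<P>"
  shows "Group.monoid (Sigma_monoid X \<P>)"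
proof -
  let ?M = "Sigma_monoid X \<P>"
  have ext: "f \<in> extensional X" and maps: "x \<in> X \<Longrightarrow> f x \<in> X" if "f \<in> carrier ?M" for f x
    using that by (auto simp: Sigma_monoid_def Sigma_part_def T_part_def PiE_iff)
  show ?thesis
  proof (rule monoidI)
    show "f \<otimes>\<^bsub>?M\<^esub> g \<in> carrier ?M" if "f \<in> carrier ?M" "g \<in> carrier ?M" for f g
      using Sigma_part_compose[OF assms] that by (simp add: Sigma_monoid_def)
    show "\<one>\<^bsub>?M\<^esub> \<in> carrier ?M"
      using Sigma_part_id[OF assms] by (simp add: Sigma_monoid_def)
    show "f \<otimes>\<^bsub>?M\<^esub> g \<otimes>\<^bsub>?M\<^esub> h = f \<otimes>\<^bsub>?M\<^esub> (g \<otimes>\<^bsub>?M\<^esub> h)"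
      if "f \<in> carrier ?M" for f g h
      by (rule extensionalityI[of _ X]) (simp_all add: Sigma_monoid_def compose_def maps[OF that])
    show "\<one>\<^bsub>?M\<^esub> \<otimes>\<^bsub>?M\<^esub> f = f" if "f \<in> carrier ?M" for f
      by (rule extensionalityI[of _ X]) (simp_all add: Sigma_monoid_def compose_def ext[OF that])
    show "f \<otimes>\<^bsub>?M\<^esub> \<one>\<^bsub>?M\<^esub> = f" if "f \<in> carrier ?M" for f
      by (rule extensionalityI[of _ X])
        (simp_all add: Sigma_monoid_def compose_def ext[OF that] maps[OF that])
  qed
qed

lemma character_eq_iff:
  assumes "indexed_partition X m P" "f \<in> T_part X (P ` index_set m)"
    "i \<in> index_set m" "j \<in> index_set m"
  shows "character m P f i = j \<longleftrightarrow> f ` P i \<subseteq> P j"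
proof -
  have part: "partition_on X (P ` index_set m)" and inj: "inj_on P (index_set m)"
    using assms(1) by (auto simp: indexed_partition_def)
  have ne: "P i \<noteq> {}" using part assms(3) by (auto simp: partition_on_def)
  have uniq: "k = l" if "k \<in> index_set m" "l \<in> index_set m" "f ` P i \<subseteq> P k" "f ` P i \<subseteq> P l" for k l
  proof (rule ccontr)
    assume "k \<noteq> l"
    then have "P k \<noteq> P l" using inj that by (auto dest: inj_onD)
    then have "P k \<inter> P l = {}" using part that(1,2) by (auto simp: partition_on_def disjoint_def)
    then show False using that(3,4) ne by blast
  qed
  obtain k where k: "k \<in> index_set m" "f ` P i \<subseteq> P k"
    using assms(2,3) by (auto simp: T_part_def)
  have "character m P f i = k"
    unfolding character_def using k assms(3) uniq by (auto intro: the_equality)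
  then show ?thesis using uniq k assms(4) by blast
qed

end

theory Submission
  imports Defs
begin

text \<open>
  An element \<open>f\<close> of \<open>\<Sigma>(X, \<P>)\<close> sends blocks into blocks and meets every block, so it induces a
  surjection \<open>\<P> \<rightarrow> \<P>\<close>; as \<open>\<P>\<close> is finite, this is a permutation
  (\<open>Sigma_part_block_map_inj\<close>). The argument is carried out for an unindexed family of blocks;
  the statement about characters is a translation of it.

  If \<open>f = f u f\<close> with a unit \<open>u\<close>, and \<open>f\<close> sends \<open>A\<close> into \<open>B\<close>, then \<open>u\<close> sends \<open>B\<close> into a block that
  \<open>f\<close> sends back into \<open>B\<close>, and by injectivity this block is \<open>A\<close>. The inverse of \<open>u\<close> is
  again block preserving, so it sends \<open>A\<close> into \<open>B\<close>, and \<open>u\<close> restricts to a bijection between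
  \<open>B\<close> and \<open>A\<close>.

  Conversely, if corresponding blocks have equal size, then on each block \<open>B\<close> a right inverse of
  \<open>f\<close> on \<open>f ` A\<close> extends to a bijection \<open>B \<rightarrow> A\<close> (\<open>extend_section_to_bij\<close>). These bijections
  together form one permutation \<open>u\<close> of \<open>X\<close> that permutes the blocks, hence a unit
  (\<open>block_permutation_in_Units\<close>), and \<open>f = f u f\<close> by construction.
\<close>

section \<open>The map induced on blocks\<close>

lemma Sigma_part_extensional:
  "f \<in> Sigma_part X \<P> \<Longrightarrow> f \<in> extensional X"
  by (auto simp: Sigma_part_def T_part_def PiE_iff)

lemma Sigma_part_block:
  assumes "f \<in> Sigma_part X \<P>" "A \<in> \<P>"
  obtains B where "B \<in> \<P>" "f ` A \<subseteq> B"
  using assms unfolding Sigma_part_def T_part_def by blast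

lemma partition_on_block_eq:
  assumes "partition_on X \<P>" "A \<in> \<P>" "B \<in> \<P>" "x \<in> A" "x \<in> B"
  shows "A = B"
  using assms by (auto simp: partition_on_def disjoint_def)

text \<open>Meeting a block \<open>B\<close> at \<open>f x\<close> forces the whole block of \<open>x\<close> to be sent into \<open>B\<close>; hence the
  map that \<open>f\<close> induces on blocks is surjective.\<close>

lemma Sigma_part_block_map_surj:
  assumes part: "partition_on X \<P>" and f: "f \<in> Sigma_part X \<P>" and B: "B \<in> \<P>"
  obtains A where "A \<in> \<P>" "f ` A \<subseteq> B"
proof -
  obtain x where x: "x \<in> X" "f x \<in> B"
    using f B unfolding Sigma_part_def by blast
  obtain A where A: "A \<in> \<P>" "x \<in> A"
    using x(1) part by (auto simp: partition_on_def)
  obtain C where C: "C \<in> \<P>" "f ` A \<subseteq> C"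
    using Sigma_part_block[OF f A(1)] .
  have "C = B"
    using partition_on_block_eq[OF part C(1) B, of "f x"] A(2) C(2) x(2) by blast
  with A(1) C(2) that show thesis by blast
qed

text \<open>A surjective self-map of a finite set is injective; this is applied to the map induced
  on blocks.\<close>

lemma Sigma_part_block_map_inj:
  assumes part: "partition_on X \<P>" and fin: "finite \<P>" and f: "f \<in> Sigma_part X \<P>"
    and blocks: "A \<in> \<P>" "A' \<in> \<P>" "B \<in> \<P>" and sub: "f ` A \<subseteq> B" "f ` A' \<subseteq> B"
  shows "A = A'"
proof -
  have "\<forall>C\<in>\<P>. \<exists>D. D \<in> \<P> \<and> f ` C \<subseteq> D"
    using Sigma_part_block[OF f] by metis
  then obtain g where g: "\<And>C. C \<in> \<P> \<Longrightarrow> g C \<in> \<P> \<and> f ` C \<subseteq> g C"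
    by metis
  have g_eq: "g C = D" if "C \<in> \<P>" "D \<in> \<P>" "f ` C \<subseteq> D" for C D
  proof -
    have "C \<noteq> {}"
      using part that(1) by (auto simp: partition_on_def)
    then obtain x where "x \<in> C"
      by blast
    then show ?thesis
      using partition_on_block_eq[OF part, of "g C" D "f x"] g[OF that(1)] that(2,3) by blast
  qed
  have "\<P> \<subseteq> g ` \<P>"
  proof
    fix D assume D: "D \<in> \<P>"
    then obtain C where "C \<in> \<P>" "f ` C \<subseteq> D"
      using Sigma_part_block_map_surj[OF part f] by blast
    with D g_eq show "D \<in> g ` \<P>" by blast
  qed
  then have "inj_on g \<P>"
    by (rule finite_surj_inj[OF fin])
  moreover have "g A = g A'"
    using g_eq blocks sub by simp
  ultimately show ?thesis
    using blocks by (auto dest: inj_onD)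
qed

section \<open>Units from block permutations\<close>

text \<open>An injection that permutes the blocks is a permutation of \<open>X\<close> whose inverse permutes the
  blocks as well, so both lie in \<open>\<Sigma>(X, \<P>)\<close>.\<close>

lemma block_permutation_in_Units:
  assumes part: "partition_on X \<P>" and ext: "u \<in> extensional X"
    and inj: "inj_on u X" and perm: "(`) u ` \<P> = \<P>"
  shows "u \<in> Units (Sigma_monoid X \<P>)"
proof -
  have U: "\<Union>\<P> = X" and ne: "\<And>A. A \<in> \<P> \<Longrightarrow> A \<noteq> {}"
    using part by (auto simp: partition_on_def)
  have "u ` X = \<Union>((`) u ` \<P>)"
    using U by blast
  then have surj: "u ` X = X"
    using perm U by simp
  define v where "v = restrict (inv_into X u) X"
  have vu: "v (u x) = x" if "x \<in> X" for x
    using that inj surj by (auto simp: v_def)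
  have uv: "u (v x) = x" if "x \<in> X" for x
    using that surj by (auto simp: v_def f_inv_into_f)
  have u_maps: "u x \<in> X" if "x \<in> X" for x
    using imageI[OF that, of u] surj by simp
  have v_maps: "v x \<in> X" if "x \<in> X" for x
    using that surj inv_into_into[of x u X] by (simp add: v_def)
  have v_perm: "(`) v ` \<P> = \<P>"
  proof -
    have "v ` u ` A = A" if "A \<in> \<P>" for A
    proof -
      have "v (u x) = x" if "x \<in> A" for x
        using vu that \<open>A \<in> \<P>\<close> U by blast
      then show ?thesis
        by (simp add: image_image)
    qed
    then have "(`) v ` (`) u ` \<P> = \<P>"
      by (simp add: image_image[of "(`) v" "(`) u"])
    with perm show ?thesis by simp
  qed
  have mem: "w \<in> Sigma_part X \<P>"
    if "w \<in> extensional X" "\<And>x. x \<in> X \<Longrightarrow> w x \<in> X" "(`) w ` \<P> = \<P>" for w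
  proof -
    have "w \<in> X \<rightarrow>\<^sub>E X"
      using that(1,2) by (simp add: PiE_iff)
    moreover have "\<exists>B\<in>\<P>. w ` A \<subseteq> B" if "A \<in> \<P>" for A
      using that \<open>(`) w ` \<P> = \<P>\<close> by blast
    moreover have "w ` X \<inter> A \<noteq> {}" if "A \<in> \<P>" for A
    proof -
      obtain C where "C \<in> \<P>" "A = w ` C"
        using \<open>A \<in> \<P>\<close> \<open>(`) w ` \<P> = \<P>\<close> by blast
      then show ?thesis
        using ne[of C] U by blast
    qed
    ultimately show ?thesis
      unfolding Sigma_part_def T_part_def by blast
  qed
  have u: "u \<in> Sigma_part X \<P>"
    using mem[OF ext u_maps perm] .
  have v: "v \<in> Sigma_part X \<P>"
    using mem[OF _ v_maps v_perm] by (simp add: v_def)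
  have "compose X v u = (\<lambda>x\<in>X. x)" "compose X u v = (\<lambda>x\<in>X. x)"
    using vu uv by (auto simp: compose_def)
  with u v show ?thesis
    unfolding Units_def Sigma_monoid_def by auto
qed

section \<open>Unit-regularity and block sizes\<close>

text \<open>A section of \<open>f\<close> over \<open>f ` A\<close> is injective. As \<open>A\<close> and \<open>B\<close> have the same size, it misses
  as many elements of \<open>A\<close> as \<open>f ` A\<close> misses of \<open>B\<close>; any bijection between these completes it.\<close>

lemma extend_section_to_bij:
  assumes fin: "finite A" "finite B" and card: "card A = card B" and sub: "f ` A \<subseteq> B"
  obtains u where "bij_betw u B A" "\<And>x. x \<in> A \<Longrightarrow> f (u (f x)) = f x"
proof -
  define s where "s = inv_into A f"
  define S where "S = s ` f ` A"
  have s: "bij_betw s (f ` A) S"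
    by (simp add: S_def s_def bij_betw_def inj_on_inv_into)
  have S_sub: "S \<subseteq> A"
    unfolding S_def s_def by (auto intro: inv_into_into)
  have "card (B - f ` A) = card (A - S)"
    using card bij_betw_same_card[OF s] sub S_sub fin
    by (simp add: card_Diff_subset finite_subset)
  then obtain t where t: "bij_betw t (B - f ` A) (A - S)"
    using finite_same_card_bij[of "B - f ` A" "A - S"] fin by blast
  define u where "u y = (if y \<in> f ` A then s y else t y)" for y
  have "bij_betw u (f ` A \<union> (B - f ` A)) (S \<union> (A - S))"
    unfolding u_def using s t by (intro bij_betw_disjoint_Un) auto
  then have "bij_betw u B A"
    using sub S_sub by (simp add: Un_absorb1)
  moreover have "f (u (f x)) = f x" if "x \<in> A" for x
    using that by (simp add: u_def s_def f_inv_into_f)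
  ultimately show thesis by (rule that)
qed

lemma unit_regular_imp_card_block_eq:
  assumes part: "partition_on X \<P>" and fin: "finite \<P>" and f: "f \<in> Sigma_part X \<P>"
    and reg: "unit_regular (Sigma_monoid X \<P>) f"
    and blocks: "A \<in> \<P>" "B \<in> \<P>" and sub: "f ` A \<subseteq> B"
  shows "card A = card B"
proof -
  have inX: "x \<in> X" if "x \<in> C" "C \<in> \<P>" for x C
    using that part by (auto simp: partition_on_def)
  obtain u v where u: "u \<in> Sigma_part X \<P>" and v: "v \<in> Sigma_part X \<P>"
    and vu_fun: "compose X v u = (\<lambda>x\<in>X. x)" and uv_fun: "compose X u v = (\<lambda>x\<in>X. x)"
    and fuf_fun: "f = compose X f (compose X u f)"
    using reg unfolding unit_regular_def Units_def Sigma_monoid_def by auto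
  have vu: "v (u x) = x" and uv: "u (v x) = x" and fuf: "f (u (f x)) = f x" if "x \<in> X" for x
    using that fun_cong[OF vu_fun, of x] fun_cong[OF uv_fun, of x] fun_cong[OF fuf_fun, of x]
    by (simp_all add: compose_eq)
  have "A \<noteq> {}"
    using part blocks(1) by (auto simp: partition_on_def)
  then obtain a where a: "a \<in> A"
    by blast
  have fa: "f a \<in> B"
    using a sub by blast
  have u_sub: "u ` B \<subseteq> A"
  proof -
    obtain C where C: "C \<in> \<P>" "u ` B \<subseteq> C"
      using Sigma_part_block[OF u blocks(2)] .
    obtain D where D: "D \<in> \<P>" "f ` C \<subseteq> D"
      using Sigma_part_block[OF f C(1)] .
    have "f a \<in> D"
      using fuf[OF inX[OF a blocks(1)]] fa C(2) D(2) by (metis image_subset_iff)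
    then have "D = B"
      using partition_on_block_eq[OF part D(1) blocks(2) _ fa] by blast
    then have "C = A"
      using Sigma_part_block_map_inj[OF part fin f C(1) blocks] D(2) sub by blast
    with C(2) show ?thesis by simp
  qed
  \<comment> \<open>One point decides the block: \<open>v\<close> sends \<open>u (f a)\<close>, which lies in \<open>A\<close>, back to \<open>f a\<close>.\<close>
  have v_sub: "v ` A \<subseteq> B"
  proof -
    obtain C where C: "C \<in> \<P>" "v ` A \<subseteq> C"
      using Sigma_part_block[OF v blocks(1)] .
    have "f a \<in> C"
      using vu[OF inX[OF fa blocks(2)]] u_sub fa C(2) by (metis image_subset_iff)
    then have "C = B"
      using partition_on_block_eq[OF part C(1) blocks(2) _ fa] by blast
    with C(2) show ?thesis by simp
  qed
  have "bij_betw u B A"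
    by (rule bij_betwI[where g = v]) (use u_sub v_sub vu uv inX blocks in auto)
  then show ?thesis
    by (simp add: bij_betw_same_card)
qed

lemma card_block_eq_imp_unit_regular:
  assumes part: "partition_on X \<P>" and fin: "finite X" and f: "f \<in> Sigma_part X \<P>"
    and card: "\<And>A B. A \<in> \<P> \<Longrightarrow> B \<in> \<P> \<Longrightarrow> f ` A \<subseteq> B \<Longrightarrow> card A = card B"
  shows "unit_regular (Sigma_monoid X \<P>) f"
proof -
  have U: "\<Union>\<P> = X" and ne: "\<And>A. A \<in> \<P> \<Longrightarrow> A \<noteq> {}"
    using part by (auto simp: partition_on_def)
  have fin_\<P>: "finite \<P>" and fin_block: "\<And>A. A \<in> \<P> \<Longrightarrow> finite A"
    using fin U by (auto simp: finite_UnionD intro: finite_subset)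
  have "\<exists>A w. A \<in> \<P> \<and> f ` A \<subseteq> B \<and> bij_betw w B A \<and> (\<forall>x\<in>A. f (w (f x)) = f x)"
    if B: "B \<in> \<P>" for B
  proof -
    obtain A where A: "A \<in> \<P>" "f ` A \<subseteq> B"
      using Sigma_part_block_map_surj[OF part f B] .
    obtain w where "bij_betw w B A" "\<And>x. x \<in> A \<Longrightarrow> f (w (f x)) = f x"
      using extend_section_to_bij[OF fin_block[OF A(1)] fin_block[OF B] card[OF A(1) B A(2)] A(2)]
      by blast
    with A show ?thesis by blast
  qed
  \<comment> \<open>\<open>h\<close> is the inverse of the permutation of the blocks induced by \<open>f\<close>, and \<open>w B\<close> is the
    restriction to \<open>B\<close> of the permutation to be constructed.\<close>
  then obtain h w where h: "\<And>B. B \<in> \<P> \<Longrightarrow> h B \<in> \<P>" "\<And>B. B \<in> \<P> \<Longrightarrow> f ` h B \<subseteq> B"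
    and w: "\<And>B. B \<in> \<P> \<Longrightarrow> bij_betw (w B) B (h B)"
    and sect: "\<And>B x. B \<in> \<P> \<Longrightarrow> x \<in> h B \<Longrightarrow> f (w B (f x)) = f x"
    by metis
  have h_eq: "h B = A" if "A \<in> \<P>" "B \<in> \<P>" "f ` A \<subseteq> B" for A B
    using Sigma_part_block_map_inj[OF part fin_\<P> f] h that by blast
  have h_inj: "B = C" if BC: "B \<in> \<P>" "C \<in> \<P>" and eq: "h B = h C" for B C
  proof -
    obtain x where "x \<in> h B"
      using ne[OF h(1)[OF BC(1)]] by blast
    then show ?thesis
      using partition_on_block_eq[OF part BC, of "f x"] h(2)[OF BC(1)] h(2)[OF BC(2)] eq by blast
  qed
  define u where "u = (\<lambda>y\<in>X. w (THE B. B \<in> \<P> \<and> y \<in> B) y)"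
  have u_eq: "u y = w B y" if "B \<in> \<P>" "y \<in> B" for B y
  proof -
    have "(THE C. C \<in> \<P> \<and> y \<in> C) = B"
      using that partition_on_block_eq[OF part] by (intro the_equality) blast+
    then show ?thesis
      using that U by (auto simp: u_def)
  qed
  have u_img: "u ` B = h B" if "B \<in> \<P>" for B
    using u_eq[OF that] w[OF that] by (auto simp: bij_betw_def)
  have "inj_on u X"
  proof (rule inj_onI)
    fix y z assume yz: "y \<in> X" "z \<in> X" and eq: "u y = u z"
    obtain B C where B: "B \<in> \<P>" "y \<in> B" and C: "C \<in> \<P>" "z \<in> C"
      using yz U by blast
    have "u y \<in> h B" "u y \<in> h C"
      using u_img[OF B(1)] u_img[OF C(1)] B(2) C(2) eq by (metis imageI)+
    then have "B = C"
      using partition_on_block_eq[OF part h(1)[OF B(1)] h(1)[OF C(1)]] h_inj[OF B(1) C(1)] by blast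
    then show "y = z"
      using u_eq[OF B] u_eq[OF C] w[OF B(1)] B(2) C(2) eq by (auto simp: bij_betw_def dest: inj_onD)
  qed
  moreover have "(`) u ` \<P> = \<P>"
  proof -
    have "A \<in> h ` \<P>" if "A \<in> \<P>" for A
      using Sigma_part_block[OF f that] h_eq[OF that] that by (metis imageI)
    then have "h ` \<P> = \<P>"
      using h(1) by blast
    then show ?thesis
      using u_img by simp
  qed
  ultimately have "u \<in> Units (Sigma_monoid X \<P>)"
    by (intro block_permutation_in_Units[OF part]) (auto simp: u_def)
  moreover have "f = compose X f (compose X u f)"
  proof (rule extensionalityI[of _ X])
    show "f \<in> extensional X"
      using Sigma_part_extensional[OF f] .
    fix x assume x: "x \<in> X"
    obtain A where A: "A \<in> \<P>" "x \<in> A"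
      using x U by blast
    obtain B where B: "B \<in> \<P>" "f ` A \<subseteq> B"
      using Sigma_part_block[OF f A(1)] .
    have "f (u (f x)) = f x"
      using sect[OF B(1), of x] h_eq[OF A(1) B] u_eq[OF B(1), of "f x"] A(2) B(2) by auto
    with x show "f x = compose X f (compose X u f) x"
      by (simp add: compose_eq)
  qed simp
  ultimately show ?thesis
    using f unfolding unit_regular_def by (auto simp: Sigma_monoid_def)
qed

theorem proposition3p5:
  fixes X :: "'a set" and m :: nat and P :: "nat \<Rightarrow> 'a set" and f :: "'a \<Rightarrow> 'a"
  assumes "finite X" and "card X \<ge> 3"
    and "indexed_partition X m P"
    and "f \<in> Sigma_part X (P ` index_set m)"
  shows "unit_regular (Sigma_monoid X (P ` index_set m)) f \<longleftrightarrow>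
    (\<forall>i\<in>index_set m. \<forall>j\<in>index_set m. character m P f i = j \<longrightarrow> card (P i) = card (P j))"
proof -
  have part: "partition_on X (P ` index_set m)"
    using assms(3) by (simp add: indexed_partition_def)
  have fin: "finite (P ` index_set m)"
    by (simp add: index_set_def)
  have T: "f \<in> T_part X (P ` index_set m)"
    using assms(4) by (simp add: Sigma_part_def)
  have "unit_regular (Sigma_monoid X (P ` index_set m)) f \<longleftrightarrow>
      (\<forall>A\<in>P ` index_set m. \<forall>B\<in>P ` index_set m. f ` A \<subseteq> B \<longrightarrow> card A = card B)"
    using unit_regular_imp_card_block_eq[OF part fin assms(4)]
      card_block_eq_imp_unit_regular[OF part assms(1,4)] by blast
  then show ?thesis
    by (simp add: character_eq_iff[OF assms(3) T])
qed

end
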